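(* Let $q=2^e$ with $e>1$ odd, $\sigma=2^{(e+1)/2}$, let $\delta\in\mathbb{F}_q$ have absolute trace $1$ and let $\varepsilon=\epsilon\in\mathbb{F}_{q^2}\setminus\mathbb{F}_q$ satisfy $\epsilon^2+\epsilon+\delta=0$. For $x\in\mathbb{F}_{q^2}$ set \[ \Gamma_\varepsilon(x)=[x+(x^q+x)\varepsilon]^{\sigma+2}+(x^q+x)^{\sigma}+(x^{2q}+x^2)\varepsilon+x^{q+1}+x^2, \] and let $\mathcal{V}^3_\varepsilon$ be the variety of $\mathrm{PG}(3,q^2)$ with affine equation $z^q+z=\Gamma_\varepsilon(x)+\Gamma_\varepsilon(y)$ (in affine coordinates $x=X/J$, $y=Y/J$, $z=Z/J$). Then in the Barlotti--Cofman representation in $\mathrm{PG}(6,q)$ the affine points of $\mathcal{V}^3_\varepsilon$ correspond to the affine points of the variety \[ \mathcal{C}^3_\varepsilon:\ x_0^{\sigma+1}x_6=x_1^{\sigma+2}+x_0^{\sigma}x_1x_2+x_0^2x_2^{\sigma}+x_3^{\sigma+2}+x_0^{\sigma}x_3x_4+x_0^2x_4^{\sigma}, \] and the Barlotti--Cofman representation of $\mathcal{V}^3_\varepsilon$ is obtained by adjoining to these affine points the spread lines $r_P$, $P\in\mathcal{V}^3_\varepsilon\cap\{J=0\}$. More precisely: (i) if $e\equiv 1\pmod 4$, all spread lines $r_P$ with $P\in\mathcal{V}^3_\varepsilon\cap\{J=0\}$ are contained in $\mathcal{C}^3_\varepsilon$, so the representation is completely determined by $\mathcal{C}^3_\varepsilon$;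 (ii) if $e\equiv 3\pmod 4$, the representation consists of the points of $\mathcal{C}^3_\varepsilon$ together with $2q^2$ additional spread lines, namely the lines $r_P$ for $P\in(\ell_1\cup\ell_2)\setminus\ell_0$, where $\ell_0:J=X+Y=0$ and $\ell_i: J=c_iX+Y=0$ ($i=1,2$), with $c_1,c_2$ the two elements of $\mathbb{F}_{q^2}$ different from $1$ that are $(2^{(e-1)/2}+1)$-th roots of unity.
   Context: Points of $\mathrm{PG}(3,q^2)$ have homogeneous coordinates $(J,X,Y,Z)$, with plane at infinity $J=0$ and $P_\infty=(0,0,0,1)$; points of $\mathrm{PG}(6,q)$ have homogeneous coordinates $(x_0,\dots,x_6)$, with hyperplane at infinity $x_0=0$; $x^{\sigma+m}$ means $x^{2^{(e+1)/2}+m}$. Every $c\in\mathbb{F}_{q^2}$ is written uniquely as $c=c_0+\epsilon c_1$, $c_0,c_1\in\mathbb{F}_q$. Barlotti--Cofman representation: the affine point $(1,X,Y,Z)$ with $X=x_1+\epsilon x_2$, $Y=x_3+\epsilon x_4$, $Z=x_5+\epsilon x_6$ corresponds to $(1,x_1,\dots,x_6)$; a point $P=(0,u,v,w)$ at infinity corresponds to the spread line $r_P$ of $\{x_0=0\}$ consisting of the points $(0,u'_0,u'_1,v'_0,v'_1,w'_0,w'_1)$ with $(u',v',w')=(\lambda u,\lambda v,\lambda w)$, $\lambda\in\mathbb{F}_{q^2}^*$. Known fact (from the literature): $\mathcal{V}^3_\varepsilon\cap\{J=0\}$ equals $\ell_0$ if $e\equiv1\pmod4$ and equals $\ell_0\cup\ell_1\cup\ell_2$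 if $e\equiv 3\pmod 4$.
   Formalization: In (ii), "the points of C^3" is read as the affine points of C^3 plus the spread lines contained in C^3, since all of C^3 at infinity (the 4-space x_0=0, x_1=x_3) is larger than the representation; in (i), "completely determined" is made precise the same way. *)

theory Defs
  imports "HOL-Library.Poly_Mapping" "HOL-Library.Cardinality"
begin

section \<open>Polynomials and homogenization\<close>

text \<open>Variables are indexed by natural numbers; variable \<open>0\<close> is reserved for the homogenizing
  coordinate.\<close>

type_synonym 'a mpoly = "(nat \<Rightarrow>\<^sub>0 nat) \<Rightarrow>\<^sub>0 'a"

definition Const :: "'a \<Rightarrow> 'a::zero mpoly" where
  "Const c = Poly_Mapping.single 0 c"

definition Var :: "nat \<Rightarrow> 'a::zero_neq_one mpoly" where
  "Var i = Poly_Mapping.single (Poly_Mapping.single i 1) 1"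

definition monom_degree :: "(nat \<Rightarrow>\<^sub>0 nat) \<Rightarrow> nat" where
  "monom_degree m = (\<Sum>i\<in>Poly_Mapping.keys m. Poly_Mapping.lookup m i)"

definition total_degree :: "'a::zero mpoly \<Rightarrow> nat" where
  "total_degree p = Max (insert 0 (monom_degree ` Poly_Mapping.keys p))"

definition eval_mpoly :: "'a::comm_semiring_1 mpoly \<Rightarrow> 'a list \<Rightarrow> 'a" where
  "eval_mpoly p v =
     (\<Sum>m\<in>Poly_Mapping.keys p. Poly_Mapping.lookup p m *
        (\<Prod>i\<in>Poly_Mapping.keys m. (v ! i) ^ Poly_Mapping.lookup m i))"

definition homogenize :: "'a::comm_monoid_add mpoly \<Rightarrow> 'a mpoly" where
  "homogenize p =
     (\<Sum>m\<in>Poly_Mapping.keys p.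
        Poly_Mapping.single (m + Poly_Mapping.single 0 (total_degree p - monom_degree m))
          (Poly_Mapping.lookup p m))"

section \<open>Projective spaces\<close>

text \<open>A point is the set of all its homogeneous coordinate vectors (lists of length \<open>n + 1\<close>
  over the subfield \<open>K\<close>).\<close>

definition proj_point :: "'a::field set \<Rightarrow> 'a list \<Rightarrow> 'a list set" where
  "proj_point K v = {map ((*) c) v |c. c \<in> K \<and> c \<noteq> 0}"

definition PG :: "nat \<Rightarrow> 'a::field set \<Rightarrow> 'a list set set" where
  "PG n K = proj_point K ` {v. length v = n + 1 \<and> set v \<subseteq> K \<and> (\<exists>a\<in>set v. a \<noteq> 0)}"

definition affine_points :: "'a::field list set set \<Rightarrow> 'a list set set" where
  "affine_points S = {P \<in> S. \<forall>v\<in>P. v ! 0 \<noteq> 0}"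

definition points_at_infinity :: "'a::field list set set \<Rightarrow> 'a list set set" where
  "points_at_infinity S = {P \<in> S. \<forall>v\<in>P. v ! 0 = 0}"

text \<open>The variety of \<open>PG(3, UNIV)\<close> with affine equation \<open>f(x, y, z) = 0\<close>, where \<open>x, y, z\<close> are the
  variables \<open>1, 2, 3\<close>.\<close>

definition projective_variety :: "'a::field mpoly \<Rightarrow> 'a list set set" where
  "projective_variety f = {P \<in> PG 3 UNIV. \<forall>v\<in>P. eval_mpoly (homogenize f) v = 0}"

section \<open>The subfield of order \<open>q\<close> and the Barlotti--Cofman representation\<close>

definition Fq :: "nat \<Rightarrow> 'a::field set" where
  "Fq q = {x. x ^ q = x}"

text \<open>The list \<open>[c0, c1]\<close> with \<open>c = c0 + \<epsilon> c1\<close> and \<open>c0, c1\<close> in the subfield of order \<open>q\<close>.\<close>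

definition coords :: "nat \<Rightarrow> 'a::field \<Rightarrow> 'a \<Rightarrow> 'a list" where
  "coords q \<epsilon> c = (THE l. \<exists>c0\<in>Fq q. \<exists>c1\<in>Fq q. l = [c0, c1] \<and> c = c0 + \<epsilon> * c1)"

definition BC_affine :: "nat \<Rightarrow> 'a::field \<Rightarrow> 'a list set \<Rightarrow> 'a list set" where
  "BC_affine q \<epsilon> P =
     (THE Q. \<exists>X Y Z. [1, X, Y, Z] \<in> P \<and>
        Q = proj_point (Fq q) ([1] @ coords q \<epsilon> X @ coords q \<epsilon> Y @ coords q \<epsilon> Z))"

text \<open>For a point \<open>P\<close> at infinity; as \<open>P\<close> consists of all its coordinate vectors, \<open>(u, v, w)\<close> below
  ranges over all nonzero multiples of one such vector.\<close>

definition spread_line :: "nat \<Rightarrow> 'a::field \<Rightarrow> 'a list set \<Rightarrow> 'a list set set" where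
  "spread_line q \<epsilon> P =
     {proj_point (Fq q) ([0] @ coords q \<epsilon> u @ coords q \<epsilon> v @ coords q \<epsilon> w) |u v w.
        [0, u, v, w] \<in> P}"

definition spread :: "nat \<Rightarrow> 'a::field \<Rightarrow> 'a list set set set" where
  "spread q \<epsilon> = spread_line q \<epsilon> ` points_at_infinity (PG 3 UNIV)"

definition BC :: "nat \<Rightarrow> 'a::field \<Rightarrow> 'a list set set \<Rightarrow> 'a list set set" where
  "BC q \<epsilon> S = BC_affine q \<epsilon> ` affine_points S \<union> \<Union>(spread_line q \<epsilon> ` points_at_infinity S)"

section \<open>The varieties\<close>

text \<open>Stated over an arbitrary commutative ring, so that it can be read both as a function on the
  field and as a polynomial.\<close>

definition Gam :: "nat \<Rightarrow> nat \<Rightarrow> 'b::comm_ring_1 \<Rightarrow> 'b \<Rightarrow> 'b" where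
  "Gam q \<sigma> \<epsilon> x =
     (x + (x ^ q + x) * \<epsilon>) ^ (\<sigma> + 2) + (x ^ q + x) ^ \<sigma> + (x ^ (2 * q) + x ^ 2) * \<epsilon>
       + x ^ (q + 1) + x ^ 2"

definition V3 :: "nat \<Rightarrow> nat \<Rightarrow> 'a::field \<Rightarrow> 'a list set set" where
  "V3 q \<sigma> \<epsilon> = projective_variety
     (Var 3 ^ q + Var 3 - (Gam q \<sigma> (Const \<epsilon>) (Var 1) + Gam q \<sigma> (Const \<epsilon>) (Var 2)))"

definition C3 :: "nat \<Rightarrow> nat \<Rightarrow> 'a::field list set set" where
  "C3 q \<sigma> = {P \<in> PG 6 (Fq q). \<forall>x0 x1 x2 x3 x4 x5 x6. [x0, x1, x2, x3, x4, x5, x6] \<in> P \<longrightarrow>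
     x0 ^ (\<sigma> + 1) * x6 =
       x1 ^ (\<sigma> + 2) + x0 ^ \<sigma> * x1 * x2 + x0 ^ 2 * x2 ^ \<sigma>
       + x3 ^ (\<sigma> + 2) + x0 ^ \<sigma> * x3 * x4 + x0 ^ 2 * x4 ^ \<sigma>}"

definition inf_line :: "'a::field \<Rightarrow> 'a list set set" where
  "inf_line c = {P \<in> PG 3 UNIV. \<forall>v\<in>P. v ! 0 = 0 \<and> c * v ! 1 + v ! 2 = 0}"

text \<open>A line of the spread is recorded by \<open>C\<close> if it is contained in it.  The section of \<open>C3\<close> with the
  hyperplane at infinity is the 4-space \<open>x0 = 0, x1 = x3\<close>, which is larger than the union of these
  lines, so what \<open>C3\<close> contributes to the representation of \<open>V3\<close> is its affine points together with
  the lines of the spread contained in it, not all of its points at infinity.\<close>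

definition spread_part :: "nat \<Rightarrow> 'a::field \<Rightarrow> 'a list set set \<Rightarrow> 'a list set set" where
  "spread_part q \<epsilon> C = affine_points C \<union> \<Union>{s \<in> spread q \<epsilon>. s \<subseteq> C}"

end

theory Submission
  imports Defs
begin

text \<open>Writing \<open>x = re x + \<epsilon> * im x\<close> one has \<open>im x = x ^ q + x\<close> and \<open>re x = x + (x ^ q + x) * \<epsilon>\<close>, since
  \<open>\<epsilon> ^ q = \<epsilon> + 1\<close>, and \<open>Gam x\<close> collapses to \<open>re x ^ (\<sigma> + 2) + re x * im x + im x ^ \<sigma>\<close>; hence the two affine
  equations are the same. At infinity only the leading forms survive: \<open>V3\<close> is cut out by
  \<open>X ^ (\<sigma> + 2) = Y ^ (\<sigma> + 2)\<close>, that is by \<open>Y = c * X\<close> with \<open>c\<close> a root of unity of order dividing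
  \<open>2 ^ ((e - 1) / 2) + 1\<close>. Such a \<open>c\<close> is a cube root of unity, necessarily \<open>1\<close> if \<open>e \<equiv> 1\<close> modulo \<open>4\<close> and
  arbitrary if \<open>e \<equiv> 3\<close>, and a nontrivial one is not in the field of order \<open>q\<close> because \<open>e\<close> is odd. Hence
  \<open>C3\<close> meets the hyperplane at infinity in \<open>x1 = x3\<close>, and a spread line lies there iff all multiples
  of \<open>X\<close> and \<open>Y\<close> have the same first coordinate, i.e. iff \<open>X = Y\<close>.\<close>

section \<open>Values of homogenized polynomials\<close>

text \<open>The linear functional on polynomials with prescribed values \<open>g\<close> on
  monomials; plain evaluation and homogenized evaluation are two choices of
  \<open>g\<close>.\<close>

definition linear_ext :: "((nat \<Rightarrow>\<^sub>0 nat) \<Rightarrow> 'a) \<Rightarrow> 'a::comm_ring_1 mpoly \<Rightarrow> 'a" where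
  "linear_ext g p = (\<Sum>m\<in>Poly_Mapping.keys p. Poly_Mapping.lookup p m * g m)"

definition monom_value :: "(nat \<Rightarrow> 'a::comm_ring_1) \<Rightarrow> (nat \<Rightarrow>\<^sub>0 nat) \<Rightarrow> 'a" where
  "monom_value v m = (\<Prod>i\<in>Poly_Mapping.keys m. v i ^ Poly_Mapping.lookup m i)"

lemma linear_ext_0 [simp]: "linear_ext g 0 = 0"
  by (simp add: linear_ext_def)

lemma linear_ext_add: "linear_ext g (p + q) = linear_ext g p + linear_ext g q"
  unfolding linear_ext_def by (rule setsum_keys_plus_distrib) (auto simp: distrib_right)

lemma linear_ext_diff: "linear_ext g (p - q) = linear_ext g p - linear_ext g q"
  using linear_ext_add[of g "p - q" q] by simp

lemma linear_ext_single [simp]: "linear_ext g (Poly_Mapping.single m c) = c * g m"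
  by (simp add: linear_ext_def)

lemma linear_ext_sum: "linear_ext g (sum f A) = (\<Sum>i\<in>A. linear_ext g (f i))"
  by (induction A rule: infinite_finite_induct) (auto simp: linear_ext_add)

lemma mpoly_eq_sum_single:
  "(p :: 'a::comm_monoid_add mpoly) = (\<Sum>m\<in>Poly_Mapping.keys p. Poly_Mapping.single m (Poly_Mapping.lookup p m))"
  by (rule poly_mapping_eqI)
    (simp add: lookup_sum lookup_single when_def not_in_keys_iff_lookup_eq_zero)

text \<open>Three weights are allowed because the homogenizing weight depends on the chosen degree,
  which adds under products. The law is asked only of monomials that occur, since truncated
  subtraction breaks it above the degree bound.\<close>

lemma linear_ext_mult:
  assumes "\<And>m m'. m \<in> Poly_Mapping.keys p \<Longrightarrow> m' \<in> Poly_Mapping.keys q \<Longrightarrow> h (m + m') = f m * g m'"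
  shows "linear_ext h (p * q) = linear_ext f p * linear_ext g q"
proof -
  have "p * q = (\<Sum>m\<in>Poly_Mapping.keys p. \<Sum>m'\<in>Poly_Mapping.keys q.
      Poly_Mapping.single (m + m') (Poly_Mapping.lookup p m * Poly_Mapping.lookup q m'))"
    by (subst (1) mpoly_eq_sum_single[of p], subst (1) mpoly_eq_sum_single[of q])
      (simp add: sum_product mult_single)
  then have "linear_ext h (p * q) = (\<Sum>m\<in>Poly_Mapping.keys p. \<Sum>m'\<in>Poly_Mapping.keys q.
      Poly_Mapping.lookup p m * Poly_Mapping.lookup q m' * h (m + m'))"
    by (simp add: linear_ext_sum)
  also have "\<dots> = (\<Sum>m\<in>Poly_Mapping.keys p. \<Sum>m'\<in>Poly_Mapping.keys q.
      (Poly_Mapping.lookup p m * f m) * (Poly_Mapping.lookup q m' * g m'))"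
    by (intro sum.cong refl) (simp add: assms mult_ac)
  finally show ?thesis
    by (simp add: linear_ext_def sum_product)
qed

lemma monom_value_superset:
  "finite A \<Longrightarrow> Poly_Mapping.keys m \<subseteq> A \<Longrightarrow> monom_value v m = (\<Prod>i\<in>A. v i ^ Poly_Mapping.lookup m i)"
  unfolding monom_value_def
  by (rule prod.mono_neutral_left) (auto simp: in_keys_iff)

lemma monom_value_add: "monom_value v (m + m') = monom_value v m * monom_value v m'"
  using keys_add[of m m']
  by (simp add: monom_value_superset[where A = "Poly_Mapping.keys m \<union> Poly_Mapping.keys m'"]
      lookup_add power_add prod.distrib)

lemma monom_value_single [simp]: "monom_value v (Poly_Mapping.single i n) = v i ^ n"
  by (simp add: monom_value_def)

lemma monom_value_scale: "monom_value (\<lambda>i. c * v i) m = c ^ monom_degree m * monom_value v m"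
  by (simp add: monom_value_def monom_degree_def power_mult_distrib prod.distrib power_sum)

lemma monom_degree_add: "monom_degree (m + m') = monom_degree m + monom_degree m'"
  unfolding monom_degree_def by (rule setsum_keys_plus_distrib) auto

lemma monom_degree_single [simp]: "monom_degree (Poly_Mapping.single i n) = n"
  by (simp add: monom_degree_def)

lemma monom_degree_0 [simp]: "monom_degree 0 = 0"
  by (simp add: monom_degree_def)

lemma monom_value_0 [simp]: "monom_value v 0 = 1"
  by (simp add: monom_value_def)

text \<open>\<open>r\<close> is the value at \<open>v\<close> of \<open>p\<close> homogenized to degree \<open>d\<close>, where \<open>d\<close> may exceed the degree
  of \<open>p\<close>; fixing \<open>d\<close> makes homogenization additive.\<close>

definition hom_value :: "nat \<Rightarrow> (nat \<Rightarrow> 'a::comm_ring_1) \<Rightarrow> 'a mpoly \<Rightarrow> 'a \<Rightarrow> bool" where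
  "hom_value d v p r \<longleftrightarrow> (\<forall>m\<in>Poly_Mapping.keys p. monom_degree m \<le> d) \<and>
     linear_ext (\<lambda>m. v 0 ^ (d - monom_degree m) * monom_value v m) p = r"

lemma hom_value_Const: "hom_value 0 v (Const c) c"
  by (simp add: hom_value_def Const_def)

lemma hom_value_Var: "hom_value 1 v (Var i) (v i)"
  by (simp add: hom_value_def Var_def)

lemma hom_value_add:
  "hom_value d v p r \<Longrightarrow> hom_value d v q s \<Longrightarrow> hom_value d v (p + q) (r + s)"
  using keys_add[of p q] by (auto simp: hom_value_def linear_ext_add)

lemma hom_value_diff:
  "hom_value d v p r \<Longrightarrow> hom_value d v q s \<Longrightarrow> hom_value d v (p - q) (r - s)"
  using keys_diff[of p q] by (auto simp: hom_value_def linear_ext_diff)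

lemma hom_value_mult:
  assumes "hom_value d v p r" "hom_value d' v q s"
  shows "hom_value (d + d') v (p * q) (r * s)"
proof -
  have "linear_ext (\<lambda>m. v 0 ^ (d + d' - monom_degree m) * monom_value v m) (p * q) =
    linear_ext (\<lambda>m. v 0 ^ (d - monom_degree m) * monom_value v m) p *
    linear_ext (\<lambda>m. v 0 ^ (d' - monom_degree m) * monom_value v m) q"
  proof (rule linear_ext_mult)
    fix m m' assume "m \<in> Poly_Mapping.keys p" "m' \<in> Poly_Mapping.keys q"
    then have "monom_degree m \<le> d" "monom_degree m' \<le> d'"
      using assms by (auto simp: hom_value_def)
    then have "d + d' - (monom_degree m + monom_degree m') = (d - monom_degree m) + (d' - monom_degree m')"
      by simp
    then show "v 0 ^ (d + d' - monom_degree (m + m')) * monom_value v (m + m') =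
        (v 0 ^ (d - monom_degree m) * monom_value v m) * (v 0 ^ (d' - monom_degree m') * monom_value v m')"
      by (simp add: monom_degree_add monom_value_add power_add mult_ac)
  qed
  moreover have "monom_degree m \<le> d + d'" if "m \<in> Poly_Mapping.keys (p * q)" for m
    using that keys_mult[of p q] assms
    by (fastforce simp: hom_value_def monom_degree_add intro: add_mono)
  ultimately show ?thesis
    using assms by (auto simp: hom_value_def)
qed

lemma hom_value_power:
  assumes "hom_value d v p r"
  shows "hom_value (n * d) v (p ^ n) (r ^ n)"
proof (induction n)
  case 0
  show ?case using hom_value_Const[of v 1] by (simp add: Const_def)
next
  case (Suc n)
  show ?case using hom_value_mult[OF assms Suc] by simp
qed

text \<open>Summands of different degrees have to be brought to a common \<open>d\<close> before
  \<open>hom_value_add\<close> applies.\<close>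

lemma hom_value_lift:
  assumes "hom_value d v p r" "d \<le> d'"
  shows "hom_value d' v p (v 0 ^ (d' - d) * r)"
proof -
  have "v 0 ^ (d' - monom_degree m) = v 0 ^ (d' - d) * v 0 ^ (d - monom_degree m)"
    if "m \<in> Poly_Mapping.keys p" for m
    using assms that by (auto simp: hom_value_def simp flip: power_add)
  then show ?thesis
    using assms by (force simp: hom_value_def linear_ext_def sum_distrib_left mult_ac intro!: sum.cong)
qed

lemma hom_value_scale:
  assumes "hom_value d v p r"
  shows "hom_value d (\<lambda>i. c * v i) p (c ^ d * r)"
proof -
  have "c ^ d = c ^ (d - monom_degree m) * c ^ monom_degree m" if "m \<in> Poly_Mapping.keys p" for m
    using assms that by (auto simp: hom_value_def simp flip: power_add)
  then show ?thesis
    using assms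
    by (auto simp: hom_value_def linear_ext_def sum_distrib_left monom_value_scale
        power_mult_distrib mult_ac intro!: sum.cong)
qed

lemma hom_value_unique: "hom_value d v p r \<Longrightarrow> hom_value d v p s \<Longrightarrow> r = s"
  by (simp add: hom_value_def)

text \<open>At \<open>v 0 = 0\<close> every monomial of degree below \<open>d\<close> is killed, so
  a nonzero value exhibits a monomial of degree exactly \<open>d\<close>. This finds the degree
  without expanding the polynomial.\<close>

lemma total_degree_eqI:
  assumes "hom_value d v p r" "v 0 = 0" "r \<noteq> 0"
  shows "total_degree p = d"
proof -
  have "\<exists>m\<in>Poly_Mapping.keys p. d \<le> monom_degree m"
  proof (rule ccontr)
    assume "\<not> ?thesis"
    then have "v 0 ^ (d - monom_degree m) = 0" if "m \<in> Poly_Mapping.keys p" for m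
      using that assms(2) by (auto simp: power_0_left not_le)
    then show False
      using assms by (simp add: hom_value_def linear_ext_def)
  qed
  then show ?thesis
    using assms(1) unfolding total_degree_def hom_value_def
    by (intro Max_eqI) (auto intro: antisym)
qed

lemma hom_value_eval_homogenize:
  assumes "hom_value (total_degree p) (nth v) p r"
  shows "eval_mpoly (homogenize p) v = r"
proof -
  have "eval_mpoly (homogenize p) v = linear_ext (monom_value (nth v)) (homogenize p)"
    by (simp add: eval_mpoly_def linear_ext_def monom_value_def)
  also have "\<dots> = (\<Sum>m\<in>Poly_Mapping.keys p. Poly_Mapping.lookup p m *
      (v ! 0 ^ (total_degree p - monom_degree m) * monom_value (nth v) m))"
    by (simp add: homogenize_def linear_ext_sum monom_value_add mult_ac)
  also have "\<dots> = r"
    using assms by (simp add: hom_value_def linear_ext_def)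
  finally show ?thesis .
qed

section \<open>The homogenized equation of \<open>V3\<close>\<close>

definition Gam_hom :: "nat \<Rightarrow> nat \<Rightarrow> 'a::comm_ring_1 \<Rightarrow> 'a \<Rightarrow> 'a \<Rightarrow> 'a" where
  "Gam_hom q \<sigma> \<epsilon> a x =
     (a ^ (q - 1) * x + (x ^ q + a ^ (q - 1) * x) * \<epsilon>) ^ (\<sigma> + 2)
     + a ^ (2 * q) * (x ^ q + a ^ (q - 1) * x) ^ \<sigma>
     + a ^ (\<sigma> * q) * ((x ^ (2 * q) + a ^ (2 * q - 2) * x ^ 2) * \<epsilon>)
     + a ^ ((\<sigma> + 2) * q - (q + 1)) * x ^ (q + 1) + a ^ ((\<sigma> + 2) * q - 2) * x ^ 2"

text \<open>The common degree is that of the first summand of \<open>Gam\<close>; the powers of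
  \<open>a\<close> in \<open>Gam_hom\<close> fill up the degrees of the others.\<close>

lemma hom_value_Gam:
  assumes "q \<ge> 1" "\<sigma> \<ge> 1"
  shows "hom_value ((\<sigma> + 2) * q) v (Gam q \<sigma> (Const \<epsilon>) (Var i)) (Gam_hom q \<sigma> \<epsilon> (v 0) (v i))"
proof -
  have pow: "hom_value n v (Var i ^ n) (v i ^ n)" for n
    using hom_value_power[OF hom_value_Var] by simp
  have var: "hom_value q v (Var i) (v 0 ^ (q - 1) * v i)"
    using hom_value_lift[OF hom_value_Var] assms by simp
  note L = hom_value_add[OF pow[of q] var]
  have 1: "hom_value ((\<sigma> + 2) * q) v ((Var i + (Var i ^ q + Var i) * Const \<epsilon>) ^ (\<sigma> + 2))
     ((v 0 ^ (q - 1) * v i + (v i ^ q + v 0 ^ (q - 1) * v i) * \<epsilon>) ^ (\<sigma> + 2))"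
    using hom_value_mult[OF L hom_value_Const]
    by (intro hom_value_power hom_value_add var) simp
  have 2: "hom_value ((\<sigma> + 2) * q) v ((Var i ^ q + Var i) ^ \<sigma>)
     (v 0 ^ (2 * q) * (v i ^ q + v 0 ^ (q - 1) * v i) ^ \<sigma>)"
    using hom_value_lift[OF hom_value_power[OF L, of \<sigma>], of "(\<sigma> + 2) * q"]
    by (simp add: distrib_right mult_2)
  have "hom_value (2 * q) v (Var i ^ 2) (v 0 ^ (2 * q - 2) * v i ^ 2)"
    using hom_value_lift[OF pow[of 2]] assms by simp
  from hom_value_lift[OF hom_value_mult[OF hom_value_add[OF pow this] hom_value_Const],
      of "(\<sigma> + 2) * q"]
  have 3: "hom_value ((\<sigma> + 2) * q) v ((Var i ^ (2 * q) + Var i ^ 2) * Const \<epsilon>)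
     (v 0 ^ (\<sigma> * q) * ((v i ^ (2 * q) + v 0 ^ (2 * q - 2) * v i ^ 2) * \<epsilon>))"
    by (simp add: distrib_right)
  have "q + 1 \<le> (\<sigma> + 2) * q" "2 \<le> (\<sigma> + 2) * q"
    using assms by (auto simp: algebra_simps intro: trans_le_add2)
  then show ?thesis
    unfolding Gam_def Gam_hom_def by (intro hom_value_add 1 2 3 hom_value_lift pow)
qed

abbreviation V3_poly :: "nat \<Rightarrow> nat \<Rightarrow> 'a::field \<Rightarrow> 'a mpoly" where
  "V3_poly q \<sigma> \<epsilon> \<equiv>
     Var 3 ^ q + Var 3 - (Gam q \<sigma> (Const \<epsilon>) (Var 1) + Gam q \<sigma> (Const \<epsilon>) (Var 2))"

definition V3_form :: "nat \<Rightarrow> nat \<Rightarrow> 'a::field \<Rightarrow> (nat \<Rightarrow> 'a) \<Rightarrow> 'a" where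
  "V3_form q \<sigma> \<epsilon> v = v 0 ^ ((\<sigma> + 1) * q) * (v 3 ^ q + v 0 ^ (q - 1) * v 3)
     - (Gam_hom q \<sigma> \<epsilon> (v 0) (v 1) + Gam_hom q \<sigma> \<epsilon> (v 0) (v 2))"

lemma hom_value_V3_poly:
  assumes "q \<ge> 1" "\<sigma> \<ge> 1"
  shows "hom_value ((\<sigma> + 2) * q) v (V3_poly q \<sigma> \<epsilon>) (V3_form q \<sigma> \<epsilon> v)"
proof -
  have "hom_value q v (Var 3 ^ q) (v 3 ^ q)"
    using hom_value_power[OF hom_value_Var] by simp
  moreover have "hom_value q v (Var 3) (v 0 ^ (q - 1) * v 3)"
    using hom_value_lift[OF hom_value_Var] assms by simp
  ultimately have "hom_value q v (Var 3 ^ q + Var 3) (v 3 ^ q + v 0 ^ (q - 1) * v 3)"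
    by (rule hom_value_add)
  from hom_value_lift[OF this, of "(\<sigma> + 2) * q"] have "hom_value ((\<sigma> + 2) * q) v (Var 3 ^ q + Var 3)
      (v 0 ^ ((\<sigma> + 1) * q) * (v 3 ^ q + v 0 ^ (q - 1) * v 3))"
    by (simp add: distrib_right)
  then show ?thesis
    unfolding V3_form_def using assms by (intro hom_value_diff hom_value_add hom_value_Gam)
qed

lemma Gam_hom_0:
  assumes "q \<ge> 2" "\<sigma> \<ge> 1"
  shows "Gam_hom q \<sigma> \<epsilon> 0 x = (x ^ q * \<epsilon>) ^ (\<sigma> + 2)"
proof -
  \<comment> \<open>Strictness makes the truncated exponents of \<open>a\<close> in the last two
    summands positive, so both vanish at \<open>a = 0\<close>.\<close>
  have "(\<sigma> + 2) * q > q + 1" "(\<sigma> + 2) * q > 2"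
    using assms mult_mono[of 3 "\<sigma> + 2" 2 q] by (auto simp: algebra_simps)
  then show ?thesis
    using assms by (simp add: Gam_hom_def power_0_left)
qed

lemma Gam_hom_1: "Gam_hom q \<sigma> \<epsilon> 1 x = Gam q \<sigma> \<epsilon> x"
  by (simp add: Gam_hom_def Gam_def)

lemma eval_V3_poly:
  assumes "q \<ge> 2" "\<sigma> \<ge> 1" "\<epsilon> \<noteq> 0"
  shows "eval_mpoly (homogenize (V3_poly q \<sigma> \<epsilon>)) v = V3_form q \<sigma> \<epsilon> (nth v)"
proof (rule hom_value_eval_homogenize)
  \<comment> \<open>The point at infinity with X = 1 and the other coordinates 0: the form is
    nonzero there, which fixes the total degree.\<close>
  let ?v = "\<lambda>i::nat. if i = 1 then 1 else 0 :: 'a"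
  have "V3_form q \<sigma> \<epsilon> ?v = - (\<epsilon> ^ (\<sigma> + 2))"
    using assms by (simp add: V3_form_def Gam_hom_0 power_0_left)
  then have "total_degree (V3_poly q \<sigma> \<epsilon>) = (\<sigma> + 2) * q"
    using assms by (intro total_degree_eqI[OF hom_value_V3_poly, of _ _ ?v]) auto
  then show "hom_value (total_degree (V3_poly q \<sigma> \<epsilon>)) (nth v) (V3_poly q \<sigma> \<epsilon>)
      (V3_form q \<sigma> \<epsilon> (nth v))"
    using hom_value_V3_poly[of q \<sigma> "nth v"] assms by simp
qed

lemma V3_form_scale:
  assumes "q \<ge> 1" "\<sigma> \<ge> 1"
  shows "V3_form q \<sigma> \<epsilon> (\<lambda>i. c * v i) = c ^ ((\<sigma> + 2) * q) * V3_form q \<sigma> \<epsilon> v"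
  using hom_value_unique[OF hom_value_V3_poly hom_value_scale[OF hom_value_V3_poly]] assms by blast

section \<open>The quadratic extension\<close>

text \<open>Multiplication by a nonzero \<open>x\<close> permutes the nonzero elements; compare the
  products before and after.\<close>

lemma finite_field_power_card:
  fixes x :: "'a::{field,finite}"
  shows "x ^ CARD('a) = x"
proof (cases "x = 0")
  case False
  have "(\<Prod>y\<in>UNIV-{0}. x * y) = (\<Prod>y\<in>UNIV-{0}. y)"
    by (rule prod.reindex_bij_witness[of _ "\<lambda>y. y / x" "\<lambda>y. x * y"]) (use False in auto)
  then have "x ^ (CARD('a) - 1) = 1"
    by (simp add: prod.distrib)
  then show ?thesis
    using power_Suc[of x "CARD('a) - 1"] finite_UNIV_card_ge_0[where ?'a = 'a] by simp
qed (simp add: finite_UNIV_card_ge_0)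

text \<open>Translation by 1 permutes the ring; comparing sums leaves the cardinality. This yields
  characteristic two below.\<close>

lemma of_nat_card_eq_0: "of_nat CARD('a::{ring_1,finite}) = (0::'a)"
proof -
  have "(\<Sum>x\<in>(UNIV::'a set). x + 1) = (\<Sum>x\<in>UNIV. x)"
    by (rule sum.reindex_bij_witness[of _ "\<lambda>x. x - 1" "\<lambda>x. x + 1"]) auto
  then show ?thesis
    by (simp add: sum.distrib)
qed

lemma add_power_two_power:
  fixes x y :: "'a::comm_ring_1"
  assumes "(2::'a) = 0"
  shows "(x + y) ^ (2 ^ n) = x ^ (2 ^ n) + y ^ (2 ^ n)"
proof (induction n)
  case (Suc n)
  have "(x + y) ^ (2 ^ Suc n) = (x ^ (2 ^ n) + y ^ (2 ^ n)) ^ 2"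
    using Suc by (simp add: power_mult mult.commute[of 2])
  also have "\<dots> = (x ^ (2 ^ n)) ^ 2 + (y ^ (2 ^ n)) ^ 2"
    using assms by (simp add: power2_sum)
  finally show ?case
    by (simp add: power_mult mult.commute[of 2])
qed simp

lemma four_power_mod_3: "(4::nat) ^ j mod 3 = 1"
proof (induction j)
  case (Suc j)
  then show ?case unfolding power_Suc by presburger
qed simp

locale quadratic_extension =
  fixes e q \<sigma> :: nat and \<delta> \<epsilon> :: "'a::{field,finite}"
  assumes e_gt: "e > 1" and odd_e: "odd e"
    and q_eq: "q = 2 ^ e" and \<sigma>_eq: "\<sigma> = 2 ^ ((e + 1) div 2)"
    and card_eq: "CARD('a) = q ^ 2"
    and \<delta>_Fq: "\<delta> \<in> Fq q" and trace_\<delta>: "(\<Sum>i<e. \<delta> ^ (2 ^ i)) = 1"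
    and \<epsilon>_not_Fq: "\<epsilon> \<notin> Fq q" and \<epsilon>_root: "\<epsilon> ^ 2 + \<epsilon> + \<delta> = 0"
begin

lemma two_eq_0: "(2::'a) = 0"
proof -
  have "(2::'a) ^ (e * 2) = 0"
    using of_nat_card_eq_0[where ?'a = 'a] by (simp add: card_eq q_eq power_mult)
  then show ?thesis by simp
qed

lemma add_self [simp]: "(x::'a) + x = 0"
  using two_eq_0 by (simp flip: mult_2)

lemma uminus_eq [simp]: "- x = (x::'a)"
  using add_self[of x] by (simp only: minus_unique)

lemma add_eq_0_iff_eq: "(x::'a) + y = 0 \<longleftrightarrow> x = y"
  by (auto simp: add_eq_0_iff)

lemma add_add_self [simp]: "(x::'a) + (x + y) = y"
  by (simp flip: add.assoc)

lemma diff_eq_add: "x - y = x + (y::'a)"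
  using add_uminus_conv_diff[of x y] by simp

lemma add_power_two: "((x::'a) + y) ^ 2 = x ^ 2 + y ^ 2"
  using add_power_two_power[OF two_eq_0, of x y 1] by simp

text \<open>The iterated Frobenius map is additive with trivial kernel.\<close>

lemma power_two_power_inj: "(x::'a) ^ (2 ^ n) = y ^ (2 ^ n) \<Longrightarrow> x = y"
  using add_power_two_power[OF two_eq_0, of x y n] by (simp add: add_eq_0_iff_eq)

lemma q_ge: "q \<ge> 2" and \<sigma>_ge: "\<sigma> \<ge> 2"
proof -
  show "q \<ge> 2"
    unfolding q_eq using e_gt power_increasing[of 1 e "2::nat"] by simp
  show "\<sigma> \<ge> 2"
    unfolding \<sigma>_eq using e_gt power_increasing[of 1 "(e + 1) div 2" "2::nat"] by simp
qed

lemma q_power_add: "((x::'a) + y) ^ q = x ^ q + y ^ q"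
  unfolding q_eq by (rule add_power_two_power[OF two_eq_0])

lemma q_power_q_power [simp]: "((x::'a) ^ q) ^ q = x"
  using finite_field_power_card[of x] by (simp add: card_eq power_mult power2_eq_square)

lemma Fq_add: "x \<in> Fq q \<Longrightarrow> y \<in> Fq q \<Longrightarrow> x + y \<in> (Fq q :: 'a set)"
  by (simp add: Fq_def q_power_add)

lemma Fq_mult: "x \<in> Fq q \<Longrightarrow> y \<in> Fq q \<Longrightarrow> x * y \<in> (Fq q :: 'a set)"
  by (simp add: Fq_def power_mult_distrib)

lemma Fq_divide: "x \<in> Fq q \<Longrightarrow> y \<in> Fq q \<Longrightarrow> x / y \<in> (Fq q :: 'a set)"
  by (simp add: Fq_def power_divide)

lemma Fq_power: "x \<in> Fq q \<Longrightarrow> x ^ n \<in> (Fq q :: 'a set)"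
  unfolding Fq_def mem_Collect_eq by (metis mult.commute power_mult)

lemma Fq_0 [simp]: "0 \<in> Fq q" and Fq_1 [simp]: "1 \<in> Fq q"
  using q_ge by (auto simp: Fq_def)

lemma \<epsilon>_sq: "\<epsilon> ^ 2 = \<epsilon> + \<delta>"
  using \<epsilon>_root by (simp add: add_eq_0_iff_eq add.assoc)

lemma \<epsilon>_nonzero: "\<epsilon> \<noteq> 0"
  using \<epsilon>_not_Fq Fq_0 by metis

text \<open>Each squaring adds one more conjugate of \<delta> to \<epsilon>; after \<open>e\<close>
  squarings the accumulated sum is the absolute trace of \<delta>, which is 1.\<close>

lemma \<epsilon>_power_q: "\<epsilon> ^ q = \<epsilon> + 1"
proof -
  have "\<epsilon> ^ (2 ^ n) = \<epsilon> + (\<Sum>i<n. \<delta> ^ (2 ^ i))" for n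
  proof (induction n)
    case (Suc n)
    have "\<epsilon> ^ (2 ^ Suc n) = (\<epsilon> ^ 2) ^ (2 ^ n)"
      by (simp add: power_mult)
    also have "\<dots> = \<epsilon> ^ (2 ^ n) + \<delta> ^ (2 ^ n)"
      by (simp add: \<epsilon>_sq add_power_two_power[OF two_eq_0])
    finally show ?case
      using Suc by (simp add: add.assoc)
  qed simp
  then show ?thesis
    using trace_\<delta> by (simp add: q_eq)
qed

section \<open>Coordinates with respect to the basis 1, \<epsilon>\<close>

definition re :: "'a \<Rightarrow> 'a" where "re c = c + (c ^ q + c) * \<epsilon>"
definition im :: "'a \<Rightarrow> 'a" where "im c = c ^ q + c"

lemma im_Fq: "im c \<in> Fq q"
  by (simp add: im_def Fq_def q_power_add add.commute)

lemma re_Fq: "re c \<in> Fq q"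
  by (simp add: re_def Fq_def q_power_add power_mult_distrib \<epsilon>_power_q algebra_simps)

lemma re_im: "re c + \<epsilon> * im c = c"
  by (simp add: re_def im_def algebra_simps)

lemma im_eq:
  assumes "a \<in> Fq q" "b \<in> Fq q"
  shows "im (a + \<epsilon> * b) = b"
  using assms by (simp add: im_def Fq_def q_power_add power_mult_distrib \<epsilon>_power_q algebra_simps)

lemma re_eq:
  assumes "a \<in> Fq q" "b \<in> Fq q"
  shows "re (a + \<epsilon> * b) = a"
  using im_eq[OF assms] by (simp add: re_def im_def add.assoc mult.commute)

lemma coords_eq: "coords q \<epsilon> c = [re c, im c]"
  unfolding coords_def
proof (rule the_equality)
  show "\<exists>c0\<in>Fq q. \<exists>c1\<in>Fq q. [re c, im c] = [c0, c1] \<and> c = c0 + \<epsilon> * c1"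
    using re_Fq im_Fq re_im by metis
qed (auto simp: re_eq im_eq)

lemma re_add: "re (x + y) = re x + re y"
  by (simp add: re_def q_power_add algebra_simps)

lemma re_mult: "a \<in> Fq q \<Longrightarrow> re (a * x) = a * re x"
  by (simp add: re_def Fq_def power_mult_distrib algebra_simps)

lemma im_mult: "a \<in> Fq q \<Longrightarrow> im (a * x) = a * im x"
  by (simp add: im_def Fq_def power_mult_distrib algebra_simps)

lemma re_0 [simp]: "re 0 = 0" and im_0 [simp]: "im 0 = 0"
  using q_ge by (auto simp: re_def im_def)

lemma re_im_eqI: "re x = re y \<Longrightarrow> im x = im y \<Longrightarrow> x = y"
  using re_im by metis

text \<open>If \<open>x\<close> and \<open>y\<close> differ, scaling by the inverse of their
  difference turns the difference into 1, whose first coordinate is 1 and not 0.\<close>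

lemma re_multiples_eq_imp_eq:
  assumes "\<And>c. c \<noteq> 0 \<Longrightarrow> re (c * x) = re (c * y)"
  shows "x = y"
proof (rule ccontr)
  assume "x \<noteq> y"
  then have nz: "x + y \<noteq> 0"
    by (simp add: add_eq_0_iff_eq)
  have "re (1 / (x + y) * x) + re (1 / (x + y) * y) = re (1 / (x + y) * (x + y))"
    unfolding distrib_left re_add ..
  also have "\<dots> = 1"
    using nz by (simp add: re_def)
  finally show False
    using assms[of "1 / (x + y)"] nz by simp
qed

text \<open>The summands after the first two combine to
  \<open>im x ^ 2 * \<epsilon> + x * im x\<close>, and \<open>x + im x * \<epsilon>\<close> is
  \<open>re x\<close>.\<close>

lemma Gam_eq: "Gam q \<sigma> \<epsilon> x = re x ^ (\<sigma> + 2) + re x * im x + im x ^ \<sigma>"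
proof -
  have "(x ^ (2 * q) + x ^ 2) * \<epsilon> + x ^ (q + 1) + x ^ 2 = (x ^ q + x) ^ 2 * \<epsilon> + x * (x ^ q + x)"
    by (simp add: add_power_two power_mult mult.commute[of 2] power2_eq_square algebra_simps)
  also have "\<dots> = re x * im x"
    by (simp add: re_def im_def algebra_simps power2_eq_square)
  finally show ?thesis
    by (simp add: Gam_def re_def im_def add.assoc add.commute add.left_commute)
qed

text \<open>A cube root of unity is obtained from \<open>\<epsilon>\<close> by an Artin--Schreier shift: \<open>1 + \<delta>\<close> has trace zero as
  \<open>e\<close> is odd, so it is of the form \<open>t ^ 2 + t\<close>, with \<open>t\<close> the half trace of \<open>\<delta>\<close>.\<close>

definition half_trace :: 'a where "half_trace = (\<Sum>i\<le>(e - 1) div 2. \<delta> ^ (2 ^ (2 * i)))"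

definition \<omega> :: 'a where "\<omega> = \<epsilon> + half_trace"

text \<open>\<open>half_trace\<close> collects the conjugates of \<delta> with even index and its
  square those with odd index, so the two sums interleave.\<close>

lemma half_trace_sq: "half_trace ^ 2 + half_trace = 1 + \<delta>"
proof -
  have sq: "half_trace ^ 2 = (\<Sum>i\<le>(e - 1) div 2. \<delta> ^ (2 ^ (2 * i + 1)))"
  proof -
    have "(\<delta> ^ (2 ^ (2 * i))) ^ 2 = \<delta> ^ (2 ^ (2 * i + 1))" for i
      by (simp add: mult.commute flip: power_mult)
    then have "(\<Sum>i\<le>k. \<delta> ^ (2 ^ (2 * i))) ^ 2 = (\<Sum>i\<le>k. \<delta> ^ (2 ^ (2 * i + 1)))" for k
      by (induction k) (simp_all only: add_power_two sum.atMost_Suc, simp_all)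
    then show ?thesis by (simp add: half_trace_def)
  qed
  have "(\<Sum>i\<le>k. \<delta> ^ (2 ^ (2 * i + 1))) + (\<Sum>i\<le>k. \<delta> ^ (2 ^ (2 * i))) = (\<Sum>i<2 * k + 2. \<delta> ^ (2 ^ i))" for k
    by (induction k) (simp_all add: algebra_simps)
  then have "half_trace ^ 2 + half_trace = (\<Sum>i<2 * ((e - 1) div 2) + 2. \<delta> ^ (2 ^ i))"
    unfolding sq unfolding half_trace_def .
  \<comment> \<open>One term more than in the trace: the additional conjugate
    \<open>\<delta> ^ (2 ^ e)\<close> is \<delta> itself.\<close>
  also have "2 * ((e - 1) div 2) + 2 = Suc e"
    using odd_e e_gt by presburger
  also have "(\<Sum>i<Suc e. \<delta> ^ (2 ^ i)) = 1 + \<delta>"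
    using trace_\<delta> \<delta>_Fq by (simp add: Fq_def q_eq)
  finally show ?thesis .
qed

lemma \<omega>_sq: "\<omega> ^ 2 = \<omega> + 1"
proof -
  have "half_trace ^ 2 = half_trace + (1 + \<delta>)"
    using half_trace_sq by (metis add_add_self add.commute)
  then show ?thesis
    by (simp add: \<omega>_def add_power_two \<epsilon>_sq algebra_simps)
qed

text \<open>\<open>half_trace\<close> is a sum of powers of \<delta> and so lies in the subfield;
  \<omega> there would bring \<epsilon> along.\<close>

lemma \<omega>_not_Fq: "\<omega> \<notin> Fq q"
proof
  assume "\<omega> \<in> Fq q"
  have "(\<Sum>i\<in>A. \<delta> ^ (2 ^ (2 * i))) \<in> Fq q" for A :: "nat set"
    by (induction A rule: infinite_finite_induct) (auto intro: Fq_add Fq_power \<delta>_Fq)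
  then have "\<omega> + half_trace \<in> Fq q"
    unfolding half_trace_def using \<open>\<omega> \<in> Fq q\<close> by (intro Fq_add)
  then show False
    using \<epsilon>_not_Fq by (simp add: \<omega>_def add.assoc)
qed

text \<open>Since \<omega> is a root of \<open>t ^ 2 + t + 1\<close>, the polynomial
  \<open>t ^ 3 + 1\<close> splits into linear factors.\<close>

lemma cube_eq_1_iff: "(c::'a) ^ 3 = 1 \<longleftrightarrow> c = 1 \<or> c = \<omega> \<or> c = \<omega> + 1"
proof -
  have "(c + 1) * ((c + \<omega>) * (c + (\<omega> + 1))) = (c + 1) * (c ^ 2 + c + (\<omega> ^ 2 + \<omega>))"
    by (simp add: algebra_simps power2_eq_square)
  also have "\<omega> ^ 2 + \<omega> = 1"
    using add_add_self[of \<omega> 1] by (simp add: \<omega>_sq add.commute)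
  also have "(c + 1) * (c ^ 2 + c + 1) = c ^ 3 + 1"
    by (simp add: algebra_simps power2_eq_square power3_eq_cube)
  finally show ?thesis
    by (metis add_eq_0_iff_eq mult_eq_0_iff)
qed

lemma cube_eq_1_Fq: "c \<in> Fq q \<Longrightarrow> c ^ 3 = 1 \<Longrightarrow> c = (1::'a)"
  using cube_eq_1_iff[of c] \<omega>_not_Fq Fq_add[of "\<omega> + 1" 1] by (auto simp: add.assoc)

section \<open>Roots of unity of order dividing \<open>m\<close>\<close>

abbreviation (input) m :: nat where "m \<equiv> 2 ^ ((e - 1) div 2) + 1"

text \<open>Squaring is injective in characteristic two, so equations between powers with exponent
  \<open>\<sigma> + 2\<close> reduce to exponent \<open>m\<close>.\<close>

lemma \<sigma>_add_2: "\<sigma> + 2 = m * 2"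
proof -
  have "(e + 1) div 2 = Suc ((e - 1) div 2)"
    using odd_e by presburger
  then show ?thesis by (simp add: \<sigma>_eq)
qed

text \<open>From \<open>c ^ (2 ^ k) = 1 / c\<close> with \<open>k = (e - 1) / 2\<close> one gets \<open>c ^ (2 ^ (e - 1)) = c\<close>, hence
  \<open>c ^ q = c ^ 2\<close> and \<open>c = c ^ (q ^ 2) = c ^ 4\<close>.\<close>

lemma power_m_imp_cube:
  assumes "(c::'a) ^ m = 1"
  shows "c ^ 3 = 1"
proof -
  define k where "k = (e - 1) div 2"
  define d where "d = c ^ (2 ^ k)"
  have dc: "d * c = 1"
    using assms by (simp add: d_def k_def mult.commute)
  then have nz: "d \<noteq> 0" "c \<noteq> 0" by auto
  have "d ^ (2 ^ k) * d = (d * c) ^ (2 ^ k)"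
    by (simp add: power_mult_distrib d_def)
  then have "d ^ (2 ^ k) = c"
    using dc nz by (metis mult.commute mult_right_cancel power_one)
  then have "c ^ (2 ^ k * 2 ^ k) = c"
    by (simp add: d_def power_mult)
  moreover have "q = 2 ^ k * 2 ^ k * 2"
  proof -
    have "e = k + k + 1"
      using odd_e unfolding k_def by presburger
    then show ?thesis
      by (simp add: q_eq power_add)
  qed
  ultimately have "c ^ q = c ^ 2"
    by (metis power_mult)
  then have "c = (c ^ 2) ^ 2"
    using q_power_q_power[of c] by (metis power_commutes power_mult mult.commute)
  then have "c * 1 = c * c ^ 3"
    by (simp add: power2_eq_square power3_eq_cube mult.assoc)
  then show ?thesis
    using nz by (metis mult_left_cancel)
qed

text \<open>With \<open>e = 4 * j + 1\<close> one has \<open>m = 4 ^ j + 1\<close>, which is 2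
  modulo 3; together with \<open>c ^ 3 = 1\<close> this leaves \<open>c ^ 2 = 1\<close>.\<close>

lemma power_m_eq_1_iff_1mod4:
  assumes "e mod 4 = 1"
  shows "(c::'a) ^ m = 1 \<longleftrightarrow> c = 1"
proof
  assume c: "c ^ m = 1"
  define j where "j = e div 4"
  have "(e - 1) div 2 = 2 * j"
    using assms unfolding j_def by presburger
  then have "m mod 3 = 2"
    using four_power_mod_3[of j] by (simp add: power_mult mod_Suc)
  then have "m = 3 * (m div 3) + 2"
    by presburger
  then have "c ^ m = (c ^ 3) ^ (m div 3) * c ^ 2"
    by (metis power_add power_mult)
  then have "c ^ 2 = 1"
    using power_m_imp_cube[OF c] c by simp
  then show "c = 1"
    using power_two_power_inj[of c 1 1] by simp
qed simp

text \<open>With \<open>e = 4 * j + 3\<close> one has \<open>m = 2 * 4 ^ j + 1\<close>, a multiple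
  of 3, so every cube root of unity qualifies.\<close>

lemma power_m_eq_1_iff_3mod4:
  assumes "e mod 4 = 3"
  shows "(c::'a) ^ m = 1 \<longleftrightarrow> c = 1 \<or> c = \<omega> \<or> c = \<omega> + 1"
  unfolding cube_eq_1_iff[symmetric]
proof
  assume c: "c ^ 3 = 1"
  define j where "j = e div 4"
  have "(e - 1) div 2 = Suc (2 * j)"
    using assms unfolding j_def by presburger
  moreover have "2 * 4 ^ j mod (3::nat) = 2"
    using four_power_mod_3[of j] by presburger
  ultimately have "m mod 3 = 0"
    by (simp add: power_mult mod_Suc)
  then have "m = 3 * (m div 3)"
    by presburger
  then show "c ^ m = 1"
    using c by (metis power_mult power_one)
qed (rule power_m_imp_cube)

lemma power_\<sigma>_eq_iff: "(x::'a) ^ (\<sigma> + 2) = y ^ (\<sigma> + 2) \<longleftrightarrow> (\<exists>c. c ^ m = 1 \<and> c * x = y)"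
proof -
  have "x ^ (\<sigma> + 2) = y ^ (\<sigma> + 2) \<longleftrightarrow> (x ^ m) ^ (2 ^ 1) = (y ^ m) ^ (2 ^ 1)"
    unfolding \<sigma>_add_2 power_mult by simp
  also have "\<dots> \<longleftrightarrow> x ^ m = y ^ m"
    using power_two_power_inj by metis
  also have "\<dots> \<longleftrightarrow> (\<exists>c. c ^ m = 1 \<and> c * x = y)"
  proof
    assume xy: "x ^ m = y ^ m"
    show "\<exists>c. c ^ m = 1 \<and> c * x = y"
    proof (cases "x = 0")
      case True
      then have "y ^ m = 0" using xy by simp
      then have "y = 0" by (simp only: power_eq_0_iff)
      \<comment> \<open>Here \<open>y / x\<close> is no root of unity, but both coordinates are 0
        and any root serves.\<close>
      with True show ?thesis by (intro exI[of _ 1]) simp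
    next
      case False
      then have "x ^ m \<noteq> 0" by (simp only: power_eq_0_iff) simp
      then show ?thesis
        using xy False by (intro exI[of _ "y / x"]) (simp only: power_divide, simp)
    qed
  qed (auto simp only: power_mult_distrib mult_1)
  finally show ?thesis .
qed

text \<open>The ratio of \<open>y\<close> and \<open>x\<close> is a cube root of unity inside the
  subfield, hence 1.\<close>

lemma power_\<sigma>_inj_Fq:
  assumes "x \<in> Fq q" "y \<in> Fq q" "x ^ (\<sigma> + 2) = y ^ (\<sigma> + 2)"
  shows "x = (y::'a)"
proof -
  obtain c where c: "c ^ m = 1" "c * x = y"
    using assms(3) power_\<sigma>_eq_iff by auto
  show ?thesis
  proof (cases "x = 0")
    case False
    then have "c = y / x" using c by auto
    then have "c \<in> Fq q" using assms Fq_divide by simp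
    then show ?thesis
      using c power_m_imp_cube cube_eq_1_Fq by fastforce
  qed (use c in auto)
qed

end

section \<open>Projective points and the Barlotti--Cofman representation\<close>

text \<open>The closure properties behind rescaling of homogeneous vectors; used with
  \<open>UNIV\<close> for the 3-space and with \<open>Fq q\<close> for the 6-space.\<close>

locale subfield =
  fixes K :: "'a::field set"
  assumes one_closed: "1 \<in> K"
    and mult_closed: "x \<in> K \<Longrightarrow> y \<in> K \<Longrightarrow> x * y \<in> K"
    and divide_closed: "x \<in> K \<Longrightarrow> y \<in> K \<Longrightarrow> x / y \<in> K"
begin

lemma proj_point_self: "v \<in> proj_point K v"
  unfolding proj_point_def using one_closed by (auto intro!: exI[of _ 1] simp: map_idI)

lemma proj_point_scale:
  assumes "c \<in> K" "c \<noteq> 0"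
  shows "proj_point K (map ((*) c) v) = proj_point K v"
proof -
  have "\<exists>d'. map ((*) d) v = map ((*) d') (map ((*) c) v) \<and> d' \<in> K \<and> d' \<noteq> 0"
    if "d \<in> K" "d \<noteq> 0" for d
    using assms that by (intro exI[of _ "d / c"]) (auto simp: divide_closed)
  moreover have "\<exists>d'. map ((*) d) (map ((*) c) v) = map ((*) d') v \<and> d' \<in> K \<and> d' \<noteq> 0"
    if "d \<in> K" "d \<noteq> 0" for d
    using assms that by (intro exI[of _ "d * c"]) (auto simp: mult_closed mult.assoc)
  ultimately show ?thesis
    unfolding proj_point_def by blast
qed

lemma proj_point_eq_iff:
  "proj_point K v = proj_point K w \<longleftrightarrow> (\<exists>c\<in>K. c \<noteq> 0 \<and> w = map ((*) c) v)"
proof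
  assume "proj_point K v = proj_point K w"
  then have "w \<in> proj_point K v"
    using proj_point_self by simp
  then show "\<exists>c\<in>K. c \<noteq> 0 \<and> w = map ((*) c) v"
    by (auto simp: proj_point_def)
qed (use proj_point_scale in auto)

lemma proj_point_in_PG:
  "length v = n + 1 \<Longrightarrow> set v \<subseteq> K \<Longrightarrow> \<exists>a\<in>set v. a \<noteq> 0 \<Longrightarrow> proj_point K v \<in> PG n K"
  unfolding PG_def by blast

lemma affine_points_PG_cases:
  assumes "P \<in> affine_points (PG n K)"
  obtains v where "P = proj_point K (1 # v)" "length v = n" "set v \<subseteq> K"
proof -
  obtain w where w: "P = proj_point K w" "length w = n + 1" "set w \<subseteq> K" "w ! 0 \<noteq> 0"
    using assms proj_point_self by (auto simp: affine_points_def PG_def)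
  then obtain a v where v: "w = a # v"
    by (cases w) auto
  have "proj_point K w = proj_point K (map ((*) (1 / a)) w)"
    using w v one_closed divide_closed by (intro proj_point_scale[symmetric]) auto
  also have "map ((*) (1 / a)) w = 1 # map ((*) (1 / a)) v"
    using w v by simp
  finally show ?thesis
    using w v one_closed divide_closed mult_closed
    by (intro that[of "map ((*) (1 / a)) v"]) (auto simp del: mult_1_left times_divide_eq_left)
qed

lemma proj_point_1_affine:
  "proj_point K (1 # v) \<in> S \<Longrightarrow> proj_point K (1 # v) \<in> affine_points S"
  by (auto simp: affine_points_def proj_point_def)

lemma points_at_infinity_PG_cases:
  assumes "P \<in> points_at_infinity (PG n K)"
  obtains v where "P = proj_point K (0 # v)" "length v = n" "\<exists>a\<in>set v. a \<noteq> 0"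
proof -
  obtain w where w: "P = proj_point K w" "length w = n + 1" "\<exists>a\<in>set w. a \<noteq> 0" "w ! 0 = 0"
    using assms proj_point_self by (auto simp: points_at_infinity_def PG_def)
  then show ?thesis
    by (cases w) (auto intro: that)
qed

end

interpretation UNIV: subfield UNIV
  by standard auto

lemma affine_point_PG3_cases:
  assumes "P \<in> affine_points (PG 3 UNIV)"
  obtains x y z where "P = proj_point UNIV [1, x, y, z]"
  using assms by (elim UNIV.affine_points_PG_cases)
    (auto simp: numeral_3_eq_3 length_Suc_conv)

lemma point_at_infinity_PG3_cases:
  assumes "P \<in> points_at_infinity (PG 3 UNIV)"
  obtains x y z where "P = proj_point UNIV [0, x, y, z]" "x \<noteq> 0 \<or> y \<noteq> 0 \<or> z \<noteq> 0"
  using assms by (elim UNIV.points_at_infinity_PG_cases)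
    (auto simp: numeral_3_eq_3 length_Suc_conv)

lemma proj_point_in_inf_line_iff:
  "proj_point UNIV [0, x, y, z] \<in> inf_line c \<longleftrightarrow> (x \<noteq> 0 \<or> y \<noteq> 0 \<or> z \<noteq> 0) \<and> c * x + y = 0"
  (is "?P \<in> _ \<longleftrightarrow> ?nz \<and> ?eq")
proof -
  have "?P \<in> PG 3 UNIV \<longleftrightarrow> ?nz"
  proof
    assume "?P \<in> PG 3 UNIV"
    then show ?nz
      by (auto simp: PG_def UNIV.proj_point_eq_iff)
  qed (auto intro!: UNIV.proj_point_in_PG)
  moreover have "(\<forall>v\<in>?P. v ! 0 = 0 \<and> c * v ! 1 + v ! 2 = 0) \<longleftrightarrow> ?eq"
  proof
    assume ?eq
    then have "c * (d * x) + d * y = 0" for d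
      by (metis distrib_left mult.left_commute mult_zero_right)
    then show "\<forall>v\<in>?P. v ! 0 = 0 \<and> c * v ! 1 + v ! 2 = 0"
      by (auto simp: proj_point_def)
  next
    assume "\<forall>v\<in>?P. v ! 0 = 0 \<and> c * v ! 1 + v ! 2 = 0"
    then show ?eq
      using UNIV.proj_point_self[of "[0, x, y, z]"] by fastforce
  qed
  ultimately show ?thesis
    by (simp add: inf_line_def)
qed

lemma inf_line_subset: "inf_line c \<subseteq> points_at_infinity (PG 3 UNIV)"
  by (auto simp: inf_line_def points_at_infinity_def)

section \<open>Barlotti--Cofman points and spread lines in coordinates\<close>

context quadratic_extension
begin

sublocale Fq: subfield "Fq q :: 'a set"
  by standard (auto intro: Fq_mult Fq_divide)

text \<open>\<open>a = 1\<close> gives the images of affine points and \<open>a = 0\<close> the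
  points on spread lines, so both are handled together.\<close>

abbreviation BC_point :: "'a \<Rightarrow> 'a \<Rightarrow> 'a \<Rightarrow> 'a \<Rightarrow> 'a list set" where
  "BC_point a x y z \<equiv> proj_point (Fq q) [a, re x, im x, re y, im y, re z, im z]"

lemma re_im_nonzero: "x \<noteq> 0 \<Longrightarrow> re x \<noteq> 0 \<or> im x \<noteq> 0"
  using re_im_eqI[of x 0] by auto

lemma BC_point_in_PG:
  "a \<in> Fq q \<Longrightarrow> a \<noteq> 0 \<or> x \<noteq> 0 \<or> y \<noteq> 0 \<or> z \<noteq> 0 \<Longrightarrow> BC_point a x y z \<in> PG 6 (Fq q)"
  using re_im_nonzero[of x] re_im_nonzero[of y] re_im_nonzero[of z]
  by (intro Fq.proj_point_in_PG) (auto simp: re_Fq im_Fq)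

text \<open>\<open>re\<close> and \<open>im\<close> are linear over the subfield and jointly
  injective, so proportionality can be tested on the field elements themselves.\<close>

lemma BC_point_eq_iff:
  "BC_point a x y z = BC_point a' x' y' z' \<longleftrightarrow>
     (\<exists>c\<in>Fq q. c \<noteq> 0 \<and> a' = c * a \<and> x' = c * x \<and> y' = c * y \<and> z' = c * z)"
proof -
  have "re x' = c * re x \<and> im x' = c * im x \<longleftrightarrow> x' = c * x" if "c \<in> Fq q" for c x x'
    using re_im_eqI[of x' "c * x"] that by (auto simp: re_mult im_mult)
  then show ?thesis
    unfolding Fq.proj_point_eq_iff by (intro bex_cong) auto
qed

lemma BC_affine_eq: "BC_affine q \<epsilon> (proj_point UNIV [1, x, y, z]) = BC_point 1 x y z"
  unfolding BC_affine_def coords_eq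
  \<comment> \<open>Only one multiple of the vector has first coordinate 1, so the description is
    unique.\<close>
  by (rule the_equality) (auto simp: proj_point_def intro!: exI[of _ 1])

lemma spread_line_eq:
  "spread_line q \<epsilon> (proj_point UNIV [0, x, y, z]) =
     {BC_point 0 (c * x) (c * y) (c * z) |c. c \<noteq> 0}"
  unfolding spread_line_def coords_eq by (auto simp: proj_point_def)

text \<open>A single shared point suffices: it is a \<open>c\<close>-multiple of the vector of
  \<open>R\<close> and, up to a subfield scalar \<open>d\<close>, the vector of \<open>P\<close>, so
  the two vectors differ by the factor \<open>d / c\<close>.\<close>

lemma spread_line_subset_imp_eq:
  assumes P: "P \<in> points_at_infinity (PG 3 UNIV)" and R: "R \<in> points_at_infinity (PG 3 UNIV)"
    and sub: "spread_line q \<epsilon> P \<subseteq> spread_line q \<epsilon> R"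
  shows "P = R"
proof -
  obtain x y z where xyz: "P = proj_point UNIV [0, x, y, z]"
    using P by (rule point_at_infinity_PG3_cases)
  obtain x' y' z' where xyz': "R = proj_point UNIV [0, x', y', z']"
    using R by (rule point_at_infinity_PG3_cases)
  have "BC_point 0 (1 * x) (1 * y) (1 * z) \<in> spread_line q \<epsilon> P"
    unfolding xyz spread_line_eq by (intro CollectI exI[of _ 1]) simp
  then obtain c where "c \<noteq> 0" "BC_point 0 x y z = BC_point 0 (c * x') (c * y') (c * z')"
    using sub unfolding xyz' spread_line_eq by auto
  then obtain d where d: "d \<noteq> 0" "c * x' = d * x" "c * y' = d * y" "c * z' = d * z"
    unfolding BC_point_eq_iff by auto
  have scale: "u' = d / c * u" if "c * u' = d * u" for u u'
    using that \<open>c \<noteq> 0\<close> by (metis nonzero_mult_div_cancel_left times_divide_eq_left)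
  have eq: "[0, x', y', z'] = map ((*) (d / c)) [0, x, y, z]"
    using scale[OF d(2)] scale[OF d(3)] scale[OF d(4)] by (simp only: list.map mult_zero_right)
  have nz: "d / c \<noteq> 0"
    using \<open>c \<noteq> 0\<close> \<open>d \<noteq> 0\<close> by simp
  show ?thesis
    unfolding xyz xyz' UNIV.proj_point_eq_iff by (intro bexI[of _ "d / c"] conjI nz eq UNIV_I)
qed

lemma inj_on_spread_line: "inj_on (spread_line q \<epsilon>) (points_at_infinity (PG 3 UNIV))"
  by (rule inj_onI) (simp add: spread_line_subset_imp_eq)

section \<open>Membership in \<open>V3\<close> and \<open>C3\<close>, affinely and at
  infinity\<close>

lemma proj_point_in_V3_iff:
  assumes "length v = 4"
  shows "proj_point UNIV v \<in> V3 q \<sigma> \<epsilon> \<longleftrightarrow> proj_point UNIV v \<in> PG 3 UNIV \<and> V3_form q \<sigma> \<epsilon> (nth v) = 0"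
proof -
  \<comment> \<open>The form reads only indices 0 to 3, where \<open>nth\<close> commutes with
    \<open>map\<close> on a list of length 4.\<close>
  have "V3_form q \<sigma> \<epsilon> (nth (map ((*) c) v)) = V3_form q \<sigma> \<epsilon> (\<lambda>i. c * v ! i)" for c
    using assms by (simp add: V3_form_def)
  then have "V3_form q \<sigma> \<epsilon> (nth (map ((*) c) v)) = c ^ ((\<sigma> + 2) * q) * V3_form q \<sigma> \<epsilon> (nth v)" for c
    using V3_form_scale[of q \<sigma> \<epsilon> c "nth v"] q_ge \<sigma>_ge by simp
  then have "(\<forall>w\<in>proj_point UNIV v. V3_form q \<sigma> \<epsilon> (nth w) = 0) \<longleftrightarrow> V3_form q \<sigma> \<epsilon> (nth v) = 0"
    using UNIV.proj_point_self[of v] by (auto simp: proj_point_def)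
  moreover have "eval_mpoly (homogenize (V3_poly q \<sigma> \<epsilon>)) w = V3_form q \<sigma> \<epsilon> (nth w)" for w
    using q_ge \<sigma>_ge \<epsilon>_nonzero by (intro eval_V3_poly) auto
  ultimately show ?thesis
    by (simp only: V3_def projective_variety_def mem_Collect_eq)
qed

lemma affine_in_V3_iff:
  "proj_point UNIV [1, x, y, z] \<in> V3 q \<sigma> \<epsilon> \<longleftrightarrow> im z = Gam q \<sigma> \<epsilon> x + Gam q \<sigma> \<epsilon> y"
proof -
  have "proj_point UNIV [1, x, y, z] \<in> PG 3 UNIV"
    by (rule UNIV.proj_point_in_PG) auto
  then show ?thesis
    by (simp add: proj_point_in_V3_iff V3_form_def Gam_hom_1 im_def)
qed

lemma infinity_in_V3_iff:
  "proj_point UNIV [0, x, y, z] \<in> V3 q \<sigma> \<epsilon> \<longleftrightarrow>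
     (\<exists>c. c ^ m = 1 \<and> proj_point UNIV [0, x, y, z] \<in> inf_line c)"
proof -
  \<comment> \<open>The \<open>q\<close>-th power is an involution and the factor
    \<open>\<epsilon> ^ (\<sigma> + 2)\<close> is nonzero, so both can be stripped.\<close>
  have inj: "(a ^ q * \<epsilon>) ^ (\<sigma> + 2) = (b ^ q * \<epsilon>) ^ (\<sigma> + 2) \<longleftrightarrow> a ^ (\<sigma> + 2) = b ^ (\<sigma> + 2)" for a b
  proof -
    have "(a ^ q * \<epsilon>) ^ (\<sigma> + 2) = (a ^ (\<sigma> + 2)) ^ q * \<epsilon> ^ (\<sigma> + 2)" for a
      unfolding power_mult_distrib power_mult[symmetric] mult.commute[of q] ..
    then show ?thesis
      using \<epsilon>_nonzero q_power_q_power by (metis mult_right_cancel power_not_zero)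
  qed
  have "V3_form q \<sigma> \<epsilon> (nth [0, x, y, z]) = (x ^ q * \<epsilon>) ^ (\<sigma> + 2) + (y ^ q * \<epsilon>) ^ (\<sigma> + 2)"
    using q_ge \<sigma>_ge by (simp add: V3_form_def Gam_hom_0 power_0_left diff_eq_add)
  then have "V3_form q \<sigma> \<epsilon> (nth [0, x, y, z]) = 0 \<longleftrightarrow> x ^ (\<sigma> + 2) = y ^ (\<sigma> + 2)"
    by (simp only: add_eq_0_iff_eq inj)
  also have "\<dots> \<longleftrightarrow> (\<exists>c. c ^ m = 1 \<and> c * x + y = 0)"
    by (simp only: add_eq_0_iff_eq power_\<sigma>_eq_iff)
  finally have "V3_form q \<sigma> \<epsilon> (nth [0, x, y, z]) = 0 \<longleftrightarrow> (\<exists>c. c ^ m = 1 \<and> c * x + y = 0)" .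
  moreover have "proj_point UNIV [0, x, y, z] \<in> PG 3 UNIV \<longleftrightarrow> x \<noteq> 0 \<or> y \<noteq> 0 \<or> z \<noteq> 0"
    by (auto simp: PG_def UNIV.proj_point_eq_iff intro!: image_eqI[of _ _ "[0, x, y, z]"])
  ultimately show ?thesis
    by (subst proj_point_in_V3_iff) (auto simp: proj_point_in_inf_line_iff)
qed

text \<open>The known description of the section with J = 0, uniform in \<open>e\<close>: the root
  \<open>c = 1\<close> gives the line \<ell>\<open>_0\<close>, and the residue of \<open>e\<close>
  modulo 4 decides whether further roots exist.\<close>

lemma points_at_infinity_V3:
  "points_at_infinity (V3 q \<sigma> \<epsilon>) = (\<Union>c\<in>{c. c ^ m = 1}. inf_line c)"
proof (intro set_eqI)
  fix P
  have sub: "points_at_infinity (V3 q \<sigma> \<epsilon>) = points_at_infinity (PG 3 UNIV) \<inter> V3 q \<sigma> \<epsilon>"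
    by (auto simp: points_at_infinity_def V3_def projective_variety_def)
  show "P \<in> points_at_infinity (V3 q \<sigma> \<epsilon>) \<longleftrightarrow> P \<in> (\<Union>c\<in>{c. c ^ m = 1}. inf_line c)"
  proof (cases "P \<in> points_at_infinity (PG 3 UNIV)")
    case True
    then obtain x y z where "P = proj_point UNIV [0, x, y, z]"
      by (rule point_at_infinity_PG3_cases)
    then show ?thesis
      using True infinity_in_V3_iff sub by auto
  qed (use sub inf_line_subset in auto)
qed

lemma proj_point_in_C3_iff:
  fixes x0 x1 x2 x3 x4 x5 x6 :: 'a
  shows "proj_point (Fq q) [x0, x1, x2, x3, x4, x5, x6] \<in> C3 q \<sigma> \<longleftrightarrow>
     proj_point (Fq q) [x0, x1, x2, x3, x4, x5, x6] \<in> PG 6 (Fq q) \<and>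
     x0 ^ (\<sigma> + 1) * x6 =
       x1 ^ (\<sigma> + 2) + x0 ^ \<sigma> * x1 * x2 + x0 ^ 2 * x2 ^ \<sigma>
       + x3 ^ (\<sigma> + 2) + x0 ^ \<sigma> * x3 * x4 + x0 ^ 2 * x4 ^ \<sigma>"
proof -
  define eqn where "eqn = (\<lambda>x0 x1 x2 x3 x4 x6 :: 'a. x0 ^ (\<sigma> + 1) * x6 =
       x1 ^ (\<sigma> + 2) + x0 ^ \<sigma> * x1 * x2 + x0 ^ 2 * x2 ^ \<sigma>
       + x3 ^ (\<sigma> + 2) + x0 ^ \<sigma> * x3 * x4 + x0 ^ 2 * x4 ^ \<sigma>)"
  \<comment> \<open>All terms are homogeneous of degree \<open>\<sigma> + 2\<close>, so one vector
    decides for the whole point.\<close>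
  have "eqn (c * x0) (c * x1) (c * x2) (c * x3) (c * x4) (c * x6) \<longleftrightarrow>
     c ^ (\<sigma> + 2) * (x0 ^ (\<sigma> + 1) * x6) =
       c ^ (\<sigma> + 2) * (x1 ^ (\<sigma> + 2) + x0 ^ \<sigma> * x1 * x2 + x0 ^ 2 * x2 ^ \<sigma>
       + x3 ^ (\<sigma> + 2) + x0 ^ \<sigma> * x3 * x4 + x0 ^ 2 * x4 ^ \<sigma>)" for c
    unfolding eqn_def by (rule arg_cong2[of _ _ _ _ "(=)"])
      (simp_all add: power_mult_distrib power_add power2_eq_square distrib_left mult_ac)
  then have scale: "eqn (c * x0) (c * x1) (c * x2) (c * x3) (c * x4) (c * x6) \<longleftrightarrow>
      eqn x0 x1 x2 x3 x4 x6" if "c \<noteq> 0" for c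
    using that unfolding eqn_def by (metis mult_left_cancel power_not_zero)
  have "(\<forall>y0 y1 y2 y3 y4 y5 y6.
        [y0, y1, y2, y3, y4, y5, y6] \<in> proj_point (Fq q) [x0, x1, x2, x3, x4, x5, x6] \<longrightarrow>
        eqn y0 y1 y2 y3 y4 y6) \<longleftrightarrow> eqn x0 x1 x2 x3 x4 x6" (is "?all \<longleftrightarrow> _")
  proof
    assume ?all
    then show "eqn x0 x1 x2 x3 x4 x6"
      using Fq.proj_point_self by blast
  next
    assume x: "eqn x0 x1 x2 x3 x4 x6"
    show ?all
    proof (intro allI impI)
      fix y0 y1 y2 y3 y4 y5 y6
      assume "[y0, y1, y2, y3, y4, y5, y6] \<in> proj_point (Fq q) [x0, x1, x2, x3, x4, x5, x6]"
      then obtain c where "c \<noteq> 0" "y0 = c * x0" "y1 = c * x1" "y2 = c * x2" "y3 = c * x3"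
        "y4 = c * x4" "y6 = c * x6"
        by (auto simp: proj_point_def)
      then show "eqn y0 y1 y2 y3 y4 y6"
        using scale x by simp
    qed
  qed
  then show ?thesis
    unfolding C3_def mem_Collect_eq eqn_def by simp
qed

lemma BC_point_1_in_C3_iff:
  "BC_point 1 x y z \<in> C3 q \<sigma> \<longleftrightarrow> im z = Gam q \<sigma> \<epsilon> x + Gam q \<sigma> \<epsilon> y"
  by (simp add: proj_point_in_C3_iff BC_point_in_PG Gam_eq add_ac del: power_Suc power_add)

text \<open>At \<open>x0 = 0\<close> only the two powers with exponent \<open>\<sigma> + 2\<close>
  survive, and on the subfield that power map is injective.\<close>

lemma BC_point_0_in_C3_iff:
  assumes "x \<noteq> 0 \<or> y \<noteq> 0 \<or> z \<noteq> 0"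
  shows "BC_point 0 x y z \<in> C3 q \<sigma> \<longleftrightarrow> re x = re y"
proof -
  have "BC_point 0 x y z \<in> C3 q \<sigma> \<longleftrightarrow> re x ^ (\<sigma> + 2) + re y ^ (\<sigma> + 2) = 0"
    using assms \<sigma>_ge by (auto simp: proj_point_in_C3_iff BC_point_in_PG power_0_left)
  then show ?thesis
    unfolding add_eq_0_iff_eq using power_\<sigma>_inj_Fq[OF re_Fq re_Fq] by auto
qed

lemma spread_line_subset_C3_iff:
  assumes "P \<in> points_at_infinity (PG 3 UNIV)"
  shows "spread_line q \<epsilon> P \<subseteq> C3 q \<sigma> \<longleftrightarrow> P \<in> inf_line 1"
proof -
  obtain x y z where P: "P = proj_point UNIV [0, x, y, z]" and nz: "x \<noteq> 0 \<or> y \<noteq> 0 \<or> z \<noteq> 0"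
    using assms by (rule point_at_infinity_PG3_cases)
  have "spread_line q \<epsilon> P \<subseteq> C3 q \<sigma> \<longleftrightarrow> (\<forall>c. c \<noteq> 0 \<longrightarrow> BC_point 0 (c * x) (c * y) (c * z) \<in> C3 q \<sigma>)"
    unfolding P spread_line_eq by blast
  also have "\<dots> \<longleftrightarrow> (\<forall>c. c \<noteq> 0 \<longrightarrow> re (c * x) = re (c * y))"
    using nz by (auto simp: BC_point_0_in_C3_iff)
  \<comment> \<open>The scalar \<open>c\<close> runs over the large field; with subfield scalars
    alone only \<open>re x = re y\<close> would follow.\<close>
  also have "\<dots> \<longleftrightarrow> x = y"
    using re_multiples_eq_imp_eq[of x y] by blast
  finally show ?thesis
    using nz by (simp add: P proj_point_in_inf_line_iff add_eq_0_iff_eq)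
qed

section \<open>Affine points of both varieties parametrized by the same triples\<close>

lemma affine_points_V3:
  "affine_points (V3 q \<sigma> \<epsilon>) =
     {proj_point UNIV [1, x, y, z] |x y z. im z = Gam q \<sigma> \<epsilon> x + Gam q \<sigma> \<epsilon> y}"
proof -
  have "\<exists>x y z. P = proj_point UNIV [1, x, y, z] \<and> im z = Gam q \<sigma> \<epsilon> x + Gam q \<sigma> \<epsilon> y"
    if "P \<in> affine_points (V3 q \<sigma> \<epsilon>)" for P
  proof -
    have "P \<in> affine_points (PG 3 UNIV)" "P \<in> V3 q \<sigma> \<epsilon>"
      using that by (auto simp: affine_points_def V3_def projective_variety_def)
    then show ?thesis
      using affine_in_V3_iff by (metis affine_point_PG3_cases)
  qed
  moreover have "proj_point UNIV [1, x, y, z] \<in> affine_points (V3 q \<sigma> \<epsilon>)"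
    if "im z = Gam q \<sigma> \<epsilon> x + Gam q \<sigma> \<epsilon> y" for x y z
    using that affine_in_V3_iff by (intro UNIV.proj_point_1_affine) simp
  ultimately show ?thesis
    by blast
qed

lemma affine_points_C3:
  "affine_points (C3 q \<sigma>) = {BC_point 1 x y z |x y z. im z = Gam q \<sigma> \<epsilon> x + Gam q \<sigma> \<epsilon> y}"
proof -
  have "\<exists>x y z. P = BC_point 1 x y z \<and> im z = Gam q \<sigma> \<epsilon> x + Gam q \<sigma> \<epsilon> y"
    if P: "P \<in> affine_points (C3 q \<sigma>)" for P
  proof -
    have "P \<in> affine_points (PG 6 (Fq q))" "P \<in> C3 q \<sigma>"
      using P by (auto simp: affine_points_def C3_def)
    then obtain v where v: "P = proj_point (Fq q) (1 # v)" "length v = 6" "set v \<subseteq> Fq q"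
      by (elim Fq.affine_points_PG_cases)
    then obtain x1 x2 x3 x4 x5 x6 where "v = [x1, x2, x3, x4, x5, x6]"
      by (auto simp: numeral_eq_Suc length_Suc_conv)
    \<comment> \<open>Consecutive coordinates are reassembled in pairs into three elements of the
      large field.\<close>
    then have "P = BC_point 1 (x1 + \<epsilon> * x2) (x3 + \<epsilon> * x4) (x5 + \<epsilon> * x6)"
      using v by (simp add: re_eq im_eq)
    then show ?thesis
      using \<open>P \<in> C3 q \<sigma>\<close> BC_point_1_in_C3_iff by metis
  qed
  moreover have "BC_point 1 x y z \<in> affine_points (C3 q \<sigma>)"
    if "im z = Gam q \<sigma> \<epsilon> x + Gam q \<sigma> \<epsilon> y" for x y z
    using that unfolding BC_point_1_in_C3_iff[symmetric] by (rule Fq.proj_point_1_affine)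
  ultimately show ?thesis
    by blast
qed

lemma bij_betw_BC_affine:
  "bij_betw (BC_affine q \<epsilon>) (affine_points (V3 q \<sigma> \<epsilon>)) (affine_points (C3 q \<sigma>))"
  unfolding bij_betw_def
proof
  show "inj_on (BC_affine q \<epsilon>) (affine_points (V3 q \<sigma> \<epsilon>))"
  proof (rule inj_onI)
    fix P R
    assume "P \<in> affine_points (V3 q \<sigma> \<epsilon>)" "R \<in> affine_points (V3 q \<sigma> \<epsilon>)"
    then obtain x y z x' y' z' where
      "P = proj_point UNIV [1, x, y, z]" "R = proj_point UNIV [1, x', y', z']"
      unfolding affine_points_V3 by blast
    moreover assume "BC_affine q \<epsilon> P = BC_affine q \<epsilon> R"
    ultimately show "P = R"
      \<comment> \<open>Comparing the leading coordinates 1 forces the scalar to be 1.\<close>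
      by (auto simp: BC_affine_eq BC_point_eq_iff)
  qed
  show "BC_affine q \<epsilon> ` affine_points (V3 q \<sigma> \<epsilon>) = affine_points (C3 q \<sigma>)"
  proof (intro equalityI subsetI)
    fix Q assume "Q \<in> BC_affine q \<epsilon> ` affine_points (V3 q \<sigma> \<epsilon>)"
    then obtain x y z where "Q = BC_affine q \<epsilon> (proj_point UNIV [1, x, y, z])"
      "im z = Gam q \<sigma> \<epsilon> x + Gam q \<sigma> \<epsilon> y"
      unfolding affine_points_V3 by blast
    then show "Q \<in> affine_points (C3 q \<sigma>)"
      unfolding affine_points_C3 BC_affine_eq by blast
  next
    fix Q :: "'a list set" assume "Q \<in> affine_points (C3 q \<sigma>)"
    then obtain x y z where "Q = BC_affine q \<epsilon> (proj_point UNIV [1, x, y, z])"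
      "im z = Gam q \<sigma> \<epsilon> x + Gam q \<sigma> \<epsilon> y"
      unfolding affine_points_C3 BC_affine_eq by blast
    then show "Q \<in> BC_affine q \<epsilon> ` affine_points (V3 q \<sigma> \<epsilon>)"
      unfolding affine_points_V3 by blast
  qed
qed

lemma BC_V3:
  "BC q \<epsilon> (V3 q \<sigma> \<epsilon>) =
     affine_points (C3 q \<sigma>) \<union> \<Union>(spread_line q \<epsilon> ` points_at_infinity (V3 q \<sigma> \<epsilon>))"
  using bij_betw_BC_affine by (simp add: BC_def bij_betw_def)

lemma spread_part_C3:
  "spread_part q \<epsilon> (C3 q \<sigma>) = affine_points (C3 q \<sigma>) \<union> \<Union>(spread_line q \<epsilon> ` inf_line 1)"
proof -
  have "{s \<in> spread q \<epsilon>. s \<subseteq> C3 q \<sigma>} = spread_line q \<epsilon> ` inf_line 1"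
    using spread_line_subset_C3_iff inf_line_subset[of 1] by (auto simp: spread_def)
  then show ?thesis
    by (simp add: spread_part_def)
qed

text \<open>The lines meet only in (0,0,0,1), which is removed with \<open>inf_line 1\<close>. Every
  remaining point has nonzero X and hence a unique normal form (0,1,c,z), so each \<open>c\<close>
  contributes one point for each field element z.\<close>

lemma card_inf_lines_diff:
  assumes "finite C" "1 \<notin> C"
  shows "card ((\<Union>c\<in>C. inf_line (c::'a)) - inf_line 1) = card C * q ^ 2"
proof -
  let ?f = "\<lambda>(c::'a, z). proj_point UNIV [0, 1, c, z]"
  have "inj_on ?f (C \<times> UNIV)"
    by (rule inj_onI) (auto simp: UNIV.proj_point_eq_iff)
  moreover have "?f ` (C \<times> UNIV) = (\<Union>c\<in>C. inf_line c) - inf_line 1"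
  proof (intro equalityI subsetI)
    fix P assume P: "P \<in> (\<Union>c\<in>C. inf_line c) - inf_line 1"
    then obtain c where c: "c \<in> C" "P \<in> inf_line c"
      by blast
    then obtain x y z where xyz: "P = proj_point UNIV [0, x, y, z]" "x \<noteq> 0 \<or> y \<noteq> 0 \<or> z \<noteq> 0"
      using inf_line_subset by (blast elim: point_at_infinity_PG3_cases)
    have y: "c * x = y" "x \<noteq> y"
      using P c xyz by (auto simp: proj_point_in_inf_line_iff add_eq_0_iff_eq)
    then have x: "x \<noteq> 0"
      by auto
    have "P = proj_point UNIV (map ((*) x) [0, 1, c, z / x])"
      using x y xyz by (simp add: mult.commute)
    also have "\<dots> = ?f (c, z / x)"
      using x by (subst UNIV.proj_point_scale) auto
    finally show "P \<in> ?f ` (C \<times> UNIV)"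
      using c by blast
  qed (use assms in \<open>auto simp: proj_point_in_inf_line_iff add_eq_0_iff_eq\<close>)
  ultimately show ?thesis
    using card_image[of ?f "C \<times> UNIV"] by (simp add: card_cartesian_product card_eq)
qed

end

section \<open>The two residues of \<open>e\<close> modulo 4 combined\<close>

theorem theorem7p4:
  fixes e q \<sigma> :: nat and \<delta> \<epsilon> :: "'a::{field,finite}"
  assumes "e > 1" and "odd e"
    and "q = 2 ^ e" and "\<sigma> = 2 ^ ((e + 1) div 2)"
    and "CARD('a) = q ^ 2"
    and "\<delta> \<in> Fq q" and "(\<Sum>i<e. \<delta> ^ (2 ^ i)) = 1"
    and "\<epsilon> \<notin> Fq q" and "\<epsilon> ^ 2 + \<epsilon> + \<delta> = 0"
  shows
    "bij_betw (BC_affine q \<epsilon>) (affine_points (V3 q \<sigma> \<epsilon>)) (affine_points (C3 q \<sigma>)) \<and>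
     BC q \<epsilon> (V3 q \<sigma> \<epsilon>) =
       affine_points (C3 q \<sigma>) \<union> (\<Union>P\<in>points_at_infinity (V3 q \<sigma> \<epsilon>). spread_line q \<epsilon> P) \<and>
     (e mod 4 = 1 \<longrightarrow>
       (\<forall>P\<in>points_at_infinity (V3 q \<sigma> \<epsilon>). spread_line q \<epsilon> P \<subseteq> C3 q \<sigma>) \<and>
       BC q \<epsilon> (V3 q \<sigma> \<epsilon>) = spread_part q \<epsilon> (C3 q \<sigma>)) \<and>
     (e mod 4 = 3 \<longrightarrow>
       (\<exists>c1 c2 :: 'a. c1 \<noteq> c2 \<and>
          {c. c ^ (2 ^ ((e - 1) div 2) + 1) = 1 \<and> c \<noteq> 1} = {c1, c2} \<and>
          (let N = spread_line q \<epsilon> ` ((inf_line c1 \<union> inf_line c2) - inf_line 1)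
           in BC q \<epsilon> (V3 q \<sigma> \<epsilon>) = spread_part q \<epsilon> (C3 q \<sigma>) \<union> \<Union>N \<and>
              card N = 2 * q ^ 2 \<and>
              (\<forall>s\<in>N. \<not> s \<subseteq> C3 q \<sigma>))))"
proof -
  interpret quadratic_extension e q \<sigma> \<delta> \<epsilon>
    by unfold_locales (fact assms)+
  show ?thesis
  proof (intro conjI impI bij_betw_BC_affine BC_V3)
    assume "e mod 4 = 1"
    then have "{c::'a. c ^ m = 1} = {1}"
      using power_m_eq_1_iff_1mod4 by blast
    then have inf: "points_at_infinity (V3 q \<sigma> \<epsilon>) = inf_line 1"
      unfolding points_at_infinity_V3 by simp
    show "\<forall>P\<in>points_at_infinity (V3 q \<sigma> \<epsilon>). spread_line q \<epsilon> P \<subseteq> C3 q \<sigma>"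
      using inf inf_line_subset spread_line_subset_C3_iff by blast
    show "BC q \<epsilon> (V3 q \<sigma> \<epsilon>) = spread_part q \<epsilon> (C3 q \<sigma>)"
      by (simp add: BC_V3 inf spread_part_C3)
  next
    assume e: "e mod 4 = 3"
    \<comment> \<open>\<omega> and \<open>\<omega> + 1\<close> are the nontrivial cube roots of
      unity and serve as \<open>c1\<close> and \<open>c2\<close>.\<close>
    let ?D = "(inf_line \<omega> \<union> inf_line (\<omega> + 1)) - inf_line 1"
    have roots: "{c::'a. c ^ m = 1} = {1, \<omega>, \<omega> + 1}"
      using power_m_eq_1_iff_3mod4[OF e] by blast
    have \<omega>: "\<omega> \<noteq> 1" "\<omega> + 1 \<noteq> 1" "\<omega> \<noteq> \<omega> + 1"
      using \<omega>_not_Fq by auto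
    \<comment> \<open>Splitting off \<open>inf_line 1\<close> separates the spread lines already
      recorded by \<open>C3\<close> from the additional ones.\<close>
    have "points_at_infinity (V3 q \<sigma> \<epsilon>) = inf_line 1 \<union> ?D"
      unfolding points_at_infinity_V3 roots by blast
    then have BC: "BC q \<epsilon> (V3 q \<sigma> \<epsilon>) = spread_part q \<epsilon> (C3 q \<sigma>) \<union> \<Union>(spread_line q \<epsilon> ` ?D)"
      by (simp only: BC_V3 spread_part_C3 image_Un Union_Un_distrib Un_assoc)
    have D: "?D \<subseteq> points_at_infinity (PG 3 UNIV)"
      using inf_line_subset by blast
    \<comment> \<open>Distinct points at infinity have distinct spread lines, so counting lines is
      counting points.\<close>
    have card: "card (spread_line q \<epsilon> ` ?D) = 2 * q ^ 2"
      using card_image[OF inj_on_subset[OF inj_on_spread_line D]]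
        card_inf_lines_diff[of "{\<omega>, \<omega> + 1}"] \<omega> by simp
    have not_sub: "\<not> s \<subseteq> C3 q \<sigma>" if "s \<in> spread_line q \<epsilon> ` ?D" for s
    proof -
      obtain P where "s = spread_line q \<epsilon> P" "P \<in> ?D"
        using \<open>s \<in> spread_line q \<epsilon> ` ?D\<close> by (rule imageE)
      then show ?thesis
        using spread_line_subset_C3_iff[of P] D by (simp add: subset_iff)
    qed
    have C: "{c::'a. c ^ m = 1 \<and> c \<noteq> 1} = {\<omega>, \<omega> + 1}"
    proof -
      have "{c::'a. c ^ m = 1 \<and> c \<noteq> 1} = {c. c ^ m = 1} - {1}"
        by blast
      also have "\<dots> = {\<omega>, \<omega> + 1}"
        unfolding roots using \<omega>(1,2) by (simp add: insert_Diff_if)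
      finally show ?thesis .
    qed
    show "\<exists>c1 c2. c1 \<noteq> c2 \<and> {c. c ^ m = 1 \<and> c \<noteq> 1} = {c1, c2} \<and>
        (let N = spread_line q \<epsilon> ` ((inf_line c1 \<union> inf_line c2) - inf_line 1)
         in BC q \<epsilon> (V3 q \<sigma> \<epsilon>) = spread_part q \<epsilon> (C3 q \<sigma>) \<union> \<Union>N \<and>
            card N = 2 * q ^ 2 \<and> (\<forall>s\<in>N. \<not> s \<subseteq> C3 q \<sigma>))"
      unfolding Let_def by (intro exI[of _ \<omega>] exI[of _ "\<omega> + 1"] conjI ballI \<omega>(3) C BC card not_sub)
  qed
qed

end
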